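(* Let $F$ be the set of words (including the empty word) in two letters $\pi_+,\pi_-$, with distinguished element the empty word $\mathbb{1}$ and with the involution $w\mapsto\overline{w}$ which reverses the order of the letters and exchanges $\pi_+$ and $\pi_-$. Let $A(2)$ be the fusion ring on the free abelian group $\mathbb{Z}_F$ with basis $F$ and product $$w\otimes z=\sum_{\substack{u,x,y\in F\\ w=xu,\ z=\overline{u}y}}xy ,\qquad w,z\in F,$$ with dimension function determined by $d(\pi_+)=2$. Then the fusion ring $A(2)$ is torsion-free.
   Context: Fusion rings. Let $I$ be a set with distinguished element $\mathbb{1}$ and an involution $\alpha\mapsto\overline{\alpha}$ fixing $\mathbb{1}$. Let $\mathbb{Z}_I$ be the free abelian group with basis $I$, extend the involution $\mathbb{Z}$-linearly, and let $\tau:\mathbb{Z}_I\to\mathbb{Z}$ be the $\mathbb{Z}$-linear functional with $\tau(\alpha)=\delta_{\alpha,\mathbb{1}}$ for $\alpha\in I$. An $I$-based ring is a ring structure $\otimes$ on the abelian group $\mathbb{Z}_I$ with unit $\mathbb{1}$ such that for all $\alpha,\beta,\gamma\in I$: $\overline{\alpha\otimes\beta}=\overline{\beta}\otimes\overline{\alpha}$; $\tau(\overline{\alpha}\otimes\beta)=\delta_{\alpha,\beta}$; $\tau(\alpha\otimes\beta\otimes\gamma)\in\mathbb{N}=\{0,1,2,\dots\}$. A fusion ring is a based ring admitting a dimension function, i.e. a unital ring homomorphism $d:(\mathbb{Z}_I,\otimes)\to\mathbb{R}$ with $d(\alpha)>0$ and $d(\alpha)=d(\overline{\alpha})$ for all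 $\alpha\in I$. Cofinite based modules. Let $J$ be a set. A cofinite ($J$-)based module for $(\mathbb{Z}_I,\otimes)$ is a unital left $(\mathbb{Z}_I,\otimes)$-module structure $\otimes$ on $\mathbb{Z}_J$ together with a $\mathbb{Z}_I$-valued bilinear form $\langle\cdot,\cdot\rangle$ on $\mathbb{Z}_J$ such that for all $\alpha\in I$, $b,c\in J$: $\langle\alpha\otimes b,c\rangle=\alpha\otimes\langle b,c\rangle$; $\langle b,c\rangle=\overline{\langle c,b\rangle}$; $\tau(\langle b,c\rangle)=\delta_{b,c}$; $\tau(\alpha\otimes\langle b,c\rangle)\in\mathbb{N}$. Put $N_{\alpha b}^c=\tau(\alpha\otimes\langle b,c\rangle)$; then $\alpha\otimes b=\sum_{c}N_{\alpha b}^c\,c$. The module is connected if for all $b,c\in J$ there is $\alpha\in I$ with $N_{\alpha b}^c\neq0$. The standard based module is $\mathbb{Z}_I$ itself (basis $I$) with left multiplication and $\langle\alpha,\beta\rangle=\alpha\otimes\overline{\beta}$. Isomorphisms of based modules are module isomorphisms taking basis elements to basis elements. A fusion ring is torsion-free if every non-zero connected cofinite based module over it is isomorphic to the standard based module. *)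

theory Defs
  imports Complex_Main "HOL-Algebra.Free_Abelian_Groups" "HOL-Algebra.RingHom"
begin

section \<open>Based rings and fusion rings\<close>

text \<open>
  The index set \<open>I\<close> is a type \<open>'i\<close>, and \<open>\<int>\<^sub>I\<close> is the type
  \<^typ>\<open>'i \<Rightarrow>\<^sub>0 int\<close> of finitely supported functions, with basis elements
  \<^term>\<open>frag_of i\<close>.
\<close>

record 'i based_ring_data =
  unit_index :: 'i
  conj_index :: "'i \<Rightarrow> 'i"
  prod_on :: "('i \<Rightarrow>\<^sub>0 int) \<Rightarrow> ('i \<Rightarrow>\<^sub>0 int) \<Rightarrow> ('i \<Rightarrow>\<^sub>0 int)"

definition ring_of :: "'i based_ring_data \<Rightarrow> ('i \<Rightarrow>\<^sub>0 int) ring" where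
  "ring_of R = \<lparr>carrier = UNIV, monoid.mult = prod_on R, one = frag_of (unit_index R),
                zero = 0, add = (+)\<rparr>"

definition conj_on :: "'i based_ring_data \<Rightarrow> ('i \<Rightarrow>\<^sub>0 int) \<Rightarrow> ('i \<Rightarrow>\<^sub>0 int)" where
  "conj_on R = frag_extend (\<lambda>\<alpha>. frag_of (conj_index R \<alpha>))"

definition tau :: "'i based_ring_data \<Rightarrow> ('i \<Rightarrow>\<^sub>0 int) \<Rightarrow> int" where
  "tau R x = Poly_Mapping.lookup x (unit_index R)"

locale based_ring =
  fixes R :: "'i based_ring_data"
  assumes ring: "ring (ring_of R)"
    and conj_conj: "conj_index R (conj_index R \<alpha>) = \<alpha>"
    and conj_unit: "conj_index R (unit_index R) = unit_index R"
    and conj_prod: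
      "conj_on R (prod_on R (frag_of \<alpha>) (frag_of \<beta>)) =
         prod_on R (conj_on R (frag_of \<beta>)) (conj_on R (frag_of \<alpha>))"
    and tau_conj_prod:
      "tau R (prod_on R (conj_on R (frag_of \<alpha>)) (frag_of \<beta>)) = (if \<alpha> = \<beta> then 1 else 0)"
    and tau_prod_nonneg:
      "tau R (prod_on R (prod_on R (frag_of \<alpha>) (frag_of \<beta>)) (frag_of \<gamma>)) \<ge> 0"

definition real_ring :: "real ring" where
  "real_ring = \<lparr>carrier = UNIV, monoid.mult = (*), one = 1, zero = 0, add = (+)\<rparr>"

definition dimension_function :: "'i based_ring_data \<Rightarrow> (('i \<Rightarrow>\<^sub>0 int) \<Rightarrow> real) \<Rightarrow> bool" where
  "dimension_function R d \<longleftrightarrow>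
     d \<in> ring_hom (ring_of R) real_ring \<and>
     (\<forall>\<alpha>. d (frag_of \<alpha>) > 0 \<and> d (frag_of \<alpha>) = d (conj_on R (frag_of \<alpha>)))"

definition fusion_ring :: "'i based_ring_data \<Rightarrow> bool" where
  "fusion_ring R \<longleftrightarrow> based_ring R \<and> (\<exists>d. dimension_function R d)"


section \<open>Cofinite based modules\<close>

text \<open>
  The index set \<open>J\<close> is a subset of a type \<open>'j\<close>, possibly empty, and \<open>\<int>\<^sub>J\<close> is the
  carrier of \<^term>\<open>free_Abelian_group J\<close>, i.e. the set of all
  \<^term>\<open>v :: 'j \<Rightarrow>\<^sub>0 int\<close> with \<^term>\<open>Poly_Mapping.keys v \<subseteq> J\<close>.
  The values of \<open>act\<close> and \<open>form\<close> outside this carrier are irrelevant.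
\<close>

record ('i, 'j) based_module_data =
  basis :: "'j set"
  act :: "('i \<Rightarrow>\<^sub>0 int) \<Rightarrow> ('j \<Rightarrow>\<^sub>0 int) \<Rightarrow> ('j \<Rightarrow>\<^sub>0 int)"
  form :: "('j \<Rightarrow>\<^sub>0 int) \<Rightarrow> ('j \<Rightarrow>\<^sub>0 int) \<Rightarrow> ('i \<Rightarrow>\<^sub>0 int)"

abbreviation lattice :: "('i, 'j) based_module_data \<Rightarrow> ('j \<Rightarrow>\<^sub>0 int) monoid" where
  "lattice M \<equiv> free_Abelian_group (basis M)"

locale cofinite_based_module =
  fixes R :: "'i based_ring_data" and M :: "('i, 'j) based_module_data"
  assumes act_hom_right: "act M r \<in> hom (lattice M) (lattice M)"
    and act_hom_left: "v \<in> carrier (lattice M) \<Longrightarrow>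
          (\<lambda>r. act M r v) \<in> hom (free_Abelian_group UNIV) (lattice M)"
    and act_prod: "v \<in> carrier (lattice M) \<Longrightarrow> act M (prod_on R r s) v = act M r (act M s v)"
    and act_unit: "v \<in> carrier (lattice M) \<Longrightarrow> act M (frag_of (unit_index R)) v = v"
    and form_hom_right: "v \<in> carrier (lattice M) \<Longrightarrow>
          form M v \<in> hom (lattice M) (free_Abelian_group UNIV)"
    and form_hom_left: "w \<in> carrier (lattice M) \<Longrightarrow>
          (\<lambda>v. form M v w) \<in> hom (lattice M) (free_Abelian_group UNIV)"
    and form_act: "b \<in> basis M \<Longrightarrow> c \<in> basis M \<Longrightarrow>
          form M (act M (frag_of \<alpha>) (frag_of b)) (frag_of c) =
            prod_on R (frag_of \<alpha>) (form M (frag_of b) (frag_of c))"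
    and form_conj: "b \<in> basis M \<Longrightarrow> c \<in> basis M \<Longrightarrow>
          form M (frag_of b) (frag_of c) = conj_on R (form M (frag_of c) (frag_of b))"
    and tau_form: "b \<in> basis M \<Longrightarrow> c \<in> basis M \<Longrightarrow>
          tau R (form M (frag_of b) (frag_of c)) = (if b = c then 1 else 0)"
    and tau_prod_form_nonneg: "b \<in> basis M \<Longrightarrow> c \<in> basis M \<Longrightarrow>
          tau R (prod_on R (frag_of \<alpha>) (form M (frag_of b) (frag_of c))) \<ge> 0"

definition mult_coeff ::
  "'i based_ring_data \<Rightarrow> ('i, 'j) based_module_data \<Rightarrow> 'i \<Rightarrow> 'j \<Rightarrow> 'j \<Rightarrow> int" where
  "mult_coeff R M \<alpha> b c = tau R (prod_on R (frag_of \<alpha>) (form M (frag_of b) (frag_of c)))"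

definition connected_module ::
  "'i based_ring_data \<Rightarrow> ('i, 'j) based_module_data \<Rightarrow> bool" where
  "connected_module R M \<longleftrightarrow> (\<forall>b\<in>basis M. \<forall>c\<in>basis M. \<exists>\<alpha>. mult_coeff R M \<alpha> b c \<noteq> 0)"

definition standard_module :: "'i based_ring_data \<Rightarrow> ('i, 'i) based_module_data" where
  "standard_module R =
     \<lparr>basis = UNIV, act = prod_on R, form = (\<lambda>x y. prod_on R x (conj_on R y))\<rparr>"

definition based_module_iso ::
  "('i, 'j) based_module_data \<Rightarrow> ('i, 'k) based_module_data \<Rightarrow>
     (('j \<Rightarrow>\<^sub>0 int) \<Rightarrow> ('k \<Rightarrow>\<^sub>0 int)) \<Rightarrow> bool" where
  "based_module_iso M N \<phi> \<longleftrightarrow>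
     \<phi> \<in> iso (lattice M) (lattice N) \<and>
     (\<forall>r. \<forall>v\<in>carrier (lattice M). \<phi> (act M r v) = act N r (\<phi> v)) \<and>
     (\<forall>b\<in>basis M. \<exists>c\<in>basis N. \<phi> (frag_of b) = frag_of c)"

text \<open>
  A definition cannot quantify over types, so the type \<open>'j\<close> from which the index sets \<open>J\<close>
  are taken is a parameter. A theorem with conclusion \<open>torsion_free TYPE('j) R\<close>, where
  \<open>'j\<close> is a type variable, covers all index sets.
\<close>

definition torsion_free :: "'j itself \<Rightarrow> 'i based_ring_data \<Rightarrow> bool" where
  "torsion_free (T :: 'j itself) R \<longleftrightarrow>
     (\<forall>M :: ('i, 'j) based_module_data.
        cofinite_based_module R M \<longrightarrow> basis M \<noteq> {} \<longrightarrow> connected_module R M \<longrightarrow>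
        (\<exists>\<phi>. based_module_iso M (standard_module R) \<phi>))"


section \<open>The ring \<open>A(2)\<close>\<close>

datatype letter = Pi_plus | Pi_minus

fun conj_letter :: "letter \<Rightarrow> letter" where
  "conj_letter Pi_plus = Pi_minus"
| "conj_letter Pi_minus = Pi_plus"

definition conj_word :: "letter list \<Rightarrow> letter list" where
  "conj_word w = rev (map conj_letter w)"

definition word_prod :: "letter list \<Rightarrow> letter list \<Rightarrow> (letter list \<Rightarrow>\<^sub>0 int)" where
  "word_prod w z =
     (\<Sum>(u, x, y) \<in> {(u, x, y). w = x @ u \<and> z = conj_word u @ y}. frag_of (x @ y))"

lemma finite_word_prod_index: "finite {(u, x, y). w = x @ u \<and> z = conj_word u @ y}"
proof (rule finite_subset)
  let ?f = "\<lambda>i. (drop i w, take i w, drop (length w - i) z)"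
  have "(u, x, y) \<in> ?f ` {..length w}" if "w = x @ u" "z = conj_word u @ y" for u x y
    using that by (intro image_eqI[where x = "length x"]) (auto simp: conj_word_def)
  then show "{(u, x, y). w = x @ u \<and> z = conj_word u @ y} \<subseteq> ?f ` {..length w}"
    by blast
qed simp

definition A2 :: "letter list based_ring_data" where
  "A2 = \<lparr>unit_index = [], conj_index = conj_word,
         prod_on = (\<lambda>r s. frag_extend (\<lambda>w. frag_extend (word_prod w) s) r)\<rparr>"

end

theory Submission
  imports Defs
begin

text \<open>
  Multiplication by a single letter on the left commutes with multiplication on the right, which
  gives associativity, and \<open>A(2)\<close> is generated by its two letters, which determines the
  dimension function \<open>d\<close>.

  For torsion-freeness fix a basis element \<open>p\<close> of a connected module and put
  \<open>f(c) = d(\<langle>c, p\<rangle>)\<close>, a positive integer, and let \<open>D(c)\<close>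
  be the maximal length of a word in \<open>\<langle>c, p\<rangle>\<close>. For each letter
  \<open>a\<close>, the function \<open>f\<close> is harmonic with eigenvalue 2 for the graph with
  edges \<open>c \<rightarrow> c'\<close> when \<open>c'\<close> occurs in \<open>a \<otimes>
  c\<close>, and every \<open>c\<close> has an upper neighbour, i.e. one with \<open>D\<close>
  larger by 1. As \<open>D < f\<close>, the values of \<open>f\<close> along a path of upper
  neighbours (with \<open>a\<close> and its conjugate alternating) are unbounded, and harmonicity
  then forces \<open>f\<close> to increase along the whole path and \<open>a \<otimes> c\<close> to
  be either the upper neighbour of \<open>c\<close> or its sum with one basis element of smaller
  \<open>f\<close>. If \<open>b\<close> minimises \<open>f\<close>, this makes every \<open>w
  \<otimes> b\<close> a basis element, with \<open>f(w \<otimes> b) = d(w) f(b)\<close>. Hence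
  \<open>w \<otimes> b = b\<close> only for the empty word, so \<open>\<langle>b, b\<rangle> =
  1\<close>, and \<open>v \<mapsto> \<langle>v, b\<rangle>\<close> is the required isomorphism.
\<close>

section \<open>The ring structure of \<open>A(2)\<close>\<close>

abbreviation mul_A2 :: "(letter list \<Rightarrow>\<^sub>0 int) \<Rightarrow> (letter list \<Rightarrow>\<^sub>0 int) \<Rightarrow> (letter list \<Rightarrow>\<^sub>0 int)"
    (infixl "\<star>" 70) where
  "x \<star> y \<equiv> prod_on A2 x y"

lemma A2_simps [simp]: "unit_index A2 = []" "conj_index A2 = conj_word"
  by (simp_all add: A2_def)

lemma mul_def: "x \<star> y = frag_extend (\<lambda>w. frag_extend (word_prod w) y) x"
  by (simp add: A2_def)

lemma frag_of_induct [case_names zero one diff]: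
  assumes "P 0" "\<And>w. P (frag_of w)" "\<And>x y. P x \<Longrightarrow> P y \<Longrightarrow> P (x - y)"
  shows "P x"
  using frag_induction[of x UNIV P] assms by auto

lemma frag_extend_fun_add: "frag_extend (\<lambda>w. f w + g w) x = frag_extend f x + frag_extend g x"
  by (simp add: frag_extend_def frag_cmul_distrib2 sum.distrib)

lemma frag_extend_fun_diff: "frag_extend (\<lambda>w. f w - g w) x = frag_extend f x - frag_extend g x"
  by (induction x rule: frag_of_induct) (simp_all add: frag_extend_diff)

lemma mul_of [simp]: "frag_of w \<star> frag_of z = word_prod w z"
  by (simp add: mul_def)

lemma mul_add_left: "(x + y) \<star> z = x \<star> z + y \<star> z"
  by (simp add: mul_def frag_extend_add)

lemma mul_diff_left: "(x - y) \<star> z = x \<star> z - y \<star> z"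
  by (simp add: mul_def frag_extend_diff)

lemma mul_add_right: "x \<star> (y + z) = x \<star> y + x \<star> z"
  by (simp add: mul_def frag_extend_add frag_extend_fun_add)

lemma mul_diff_right: "x \<star> (y - z) = x \<star> y - x \<star> z"
  by (simp add: mul_def frag_extend_diff frag_extend_fun_diff)

lemma mul_zero_left [simp]: "0 \<star> z = 0"
  by (simp add: mul_def)

lemma mul_zero_right [simp]: "z \<star> 0 = 0"
  using mul_diff_right[of z 0 0] by simp

section \<open>Words, conjugation and cancellation\<close>

lemma conj_letter_conj_letter [simp]: "conj_letter (conj_letter a) = a"
  by (cases a) auto

lemma conj_letter_neq [simp]: "conj_letter a \<noteq> a" "a \<noteq> conj_letter a"
  by (cases a; simp)+

lemma letter_eq_or_conj: "b = a \<or> b = conj_letter a"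
  by (cases a; cases b) auto

lemma conj_word_simps [simp]:
  "conj_word [] = []"
  "conj_word (a # w) = conj_word w @ [conj_letter a]"
  "conj_word (w @ z) = conj_word z @ conj_word w"
  "conj_word (conj_word w) = w"
  by (simp_all add: conj_word_def rev_map comp_def)

lemma conj_word_eq_Nil [simp]: "conj_word w = [] \<longleftrightarrow> w = []"
  by (simp add: conj_word_def)

lemma word_prod_Nil_left [simp]: "word_prod [] z = frag_of z"
proof -
  have "{(u, x, y). [] = x @ u \<and> z = conj_word u @ y} = {([], [], z)}"
    by auto
  then show ?thesis by (simp add: word_prod_def)
qed

lemma word_prod_Nil_right [simp]: "word_prod w [] = frag_of w"
proof -
  have "{(u, x, y). w = x @ u \<and> [] = conj_word u @ y} = {([], w, [])}"
    by auto
  then show ?thesis by (simp add: word_prod_def)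
qed

text \<open>Either \<open>u\<close> is empty, which gives the concatenation, or it ends in
  \<open>a\<close>; then \<open>b\<close> is the conjugate of \<open>a\<close>, and removing this
  pair leaves the index triples of \<open>x\<close> and \<open>z\<close>.\<close>

lemma word_prod_snoc_Cons:
  "word_prod (x @ [a]) (b # z) =
     frag_of (x @ a # b # z) + (if b = conj_letter a then word_prod x z else 0)"
proof -
  define S where "S = {(u, x', y). x = x' @ u \<and> z = conj_word u @ y}"
  define g where "g = (\<lambda>(u, x' :: letter list, y :: letter list). (u @ [a], x', y))"
  have "{(u, x', y). x @ [a] = x' @ u \<and> b # z = conj_word u @ y} =
      insert ([], x @ [a], b # z) (if b = conj_letter a then g ` S else {})" (is "?A = ?B")
  proof (intro equalityI subsetI)
    fix t assume "t \<in> ?A"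
    moreover obtain u x' y where "t = (u, x', y)" by (cases t)
    ultimately show "t \<in> ?B"
      by (cases u rule: rev_cases) (auto simp: S_def g_def image_iff)
  qed (auto simp: S_def g_def split: if_splits)
  moreover have "finite S"
    unfolding S_def by (rule finite_word_prod_index)
  moreover have "inj_on g S" by (auto simp: inj_on_def g_def)
  moreover have "([], x @ [a], b # z) \<notin> g ` S" by (auto simp: g_def)
  moreover have "(\<Sum>(u, x', y)\<in>g ` S. frag_of (x' @ y)) = word_prod x z"
    unfolding word_prod_def S_def[symmetric] using \<open>inj_on g S\<close>
    by (subst sum.reindex) (auto simp: g_def intro!: sum.cong)
  ultimately show ?thesis
    unfolding word_prod_def[of "x @ [a]"] by auto
qed

lemma mul_one_left [simp]: "frag_of [] \<star> x = x"
proof -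
  have "word_prod [] = frag_of" by auto
  then show ?thesis by (simp add: mul_def flip: frag_expansion)
qed

lemma mul_one_right [simp]: "x \<star> frag_of [] = x"
  by (simp add: mul_def flip: frag_expansion)

section \<open>Associativity\<close>

lemma word_prod_letter_Cons:
  "word_prod [a] (b # z) = frag_of (a # b # z) + (if b = conj_letter a then frag_of z else 0)"
  using word_prod_snoc_Cons[of "[]" a b z] by simp

text \<open>The letter acts at the front of \<open>w\<close>, the cancellation with \<open>z\<close>
  at its end. Under induction from the right they collide only when \<open>w\<close> is a single
  letter.\<close>

lemma letter_mul_word_prod: "frag_of [a] \<star> word_prod w z = word_prod [a] w \<star> frag_of z"
proof (induction w arbitrary: z rule: rev_induct)
  case Nil
  show ?case by simp
next
  case (snoc c x)
  note IH = this
  \<comment> \<open>The induction hypothesis with \<open>word_prod [a] x\<close> written out, to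
    match the terms left when \<open>c\<close> and \<open>b\<close> cancel.\<close>
  have mulr: "word_prod (a # x) z' + (case x of [] \<Rightarrow> 0 | b # x' \<Rightarrow> if b = conj_letter a then word_prod x' z' else 0)
      = frag_of [a] \<star> word_prod x z'" for z'
    unfolding IH by (cases x) (auto simp: word_prod_letter_Cons mul_add_left)
  show ?case
  proof (cases z)
    case Nil
    then show ?thesis by simp
  next
    case (Cons b z')
    note z = this
    show ?thesis
    proof (cases x)
      case Nil
      then show ?thesis
        using word_prod_snoc_Cons[of "[a]" c b z']
        by (auto simp: z word_prod_letter_Cons mul_add_left mul_add_right)
    next
      case (Cons e x')
      then show ?thesis
        using word_prod_snoc_Cons[of "a # x" c b z'] word_prod_snoc_Cons[of "x" c b z']
          word_prod_snoc_Cons[of "x'" c b z'] mulr[of z']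
        by (auto simp: z word_prod_letter_Cons mul_add_left mul_add_right)
    qed
  qed
qed

lemma letter_mul_assoc: "frag_of [a] \<star> (x \<star> y) = (frag_of [a] \<star> x) \<star> y"
proof (induction x rule: frag_of_induct)
  case (one w)
  show ?case
    by (induction y rule: frag_of_induct) (simp_all add: letter_mul_word_prod mul_diff_right)
qed (simp_all add: mul_diff_left mul_diff_right)

text \<open>The letter product solved for its longest word; this is how facts about letters are
  carried to all words.\<close>

lemma frag_of_Cons:
  "frag_of (a # w) = frag_of [a] \<star> frag_of w -
     (case w of [] \<Rightarrow> 0 | b # w' \<Rightarrow> if b = conj_letter a then frag_of w' else 0)"
  by (cases w) (auto simp: word_prod_letter_Cons)

text \<open>Fits \<open>frag_of_Cons\<close>, which refers to words with one and with two letters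
  fewer.\<close>

lemma word_induct [case_names Nil Cons]:
  assumes "P []"
    and "\<And>a w. P w \<Longrightarrow> (\<And>b w'. w = b # w' \<Longrightarrow> P w') \<Longrightarrow> P (a # w)"
  shows "P w"
proof (induction w rule: length_induct)
  case (1 w)
  then show ?case by (cases w) (auto intro: assms)
qed

lemma frag_of_mul_assoc: "frag_of w \<star> (x \<star> y) = (frag_of w \<star> x) \<star> y"
proof (induction w rule: word_induct)
  case (Cons a w)
  then show ?case
    unfolding frag_of_Cons[of a w] mul_diff_left letter_mul_assoc[symmetric]
    by (auto split: list.split)
qed simp

lemma mul_assoc: "x \<star> (y \<star> z) = (x \<star> y) \<star> z"
  by (induction x rule: frag_of_induct) (simp_all add: frag_of_mul_assoc mul_diff_left)

lemma ring_A2: "ring (ring_of A2)"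
proof (intro ringI abelian_groupI monoidI)
  show "\<exists>y\<in>carrier (ring_of A2). y \<oplus>\<^bsub>ring_of A2\<^esub> x = \<zero>\<^bsub>ring_of A2\<^esub>" for x
    by (rule bexI[of _ "- x"]) (auto simp: ring_of_def)
qed (simp_all add: ring_of_def mul_add_left mul_add_right mul_assoc add.assoc add.commute[of _ y for y])

lemma lookup_frag_extend:
  "Poly_Mapping.lookup (frag_extend f x) w =
     (\<Sum>i\<in>Poly_Mapping.keys x. Poly_Mapping.lookup x i * Poly_Mapping.lookup (f i) w)"
  by (simp add: frag_extend_def lookup_sum)

lemma hom_eq_frag_extend:
  assumes "h \<in> hom (free_Abelian_group S) (free_Abelian_group T)" "Poly_Mapping.keys v \<subseteq> S"
  shows "h v = frag_extend (\<lambda>c. h (frag_of c)) v"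
  using assms(2)
proof (rule free_Abelian_group_induct)
  show "h 0 = frag_extend (\<lambda>c. h (frag_of c)) 0"
    using hom_frag_diff[OF assms(1), of 0 0] by simp
qed (simp_all add: hom_frag_diff[OF assms(1)] frag_extend_diff)

section \<open>Involution and trace\<close>

lemma conj_on_of [simp]: "conj_on A2 (frag_of w) = frag_of (conj_word w)"
  by (simp add: conj_on_def)

lemma conj_on_zero [simp]: "conj_on A2 0 = 0"
  by (simp add: conj_on_def)

lemma conj_on_add: "conj_on A2 (x + y) = conj_on A2 x + conj_on A2 y"
  by (simp add: conj_on_def frag_extend_add)

lemma conj_on_diff: "conj_on A2 (x - y) = conj_on A2 x - conj_on A2 y"
  by (simp add: conj_on_def frag_extend_diff)

lemma conj_on_conj_on [simp]: "conj_on A2 (conj_on A2 x) = x"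
  by (induction x rule: frag_of_induct) (simp_all add: conj_on_diff)

lemma conj_on_sum: "finite A \<Longrightarrow> conj_on A2 (sum g A) = (\<Sum>i\<in>A. conj_on A2 (g i))"
  by (simp add: conj_on_def frag_extend_sum)

text \<open>Conjugating the two factorisations keeps the cancelled part \<open>u\<close> and
  interchanges the roles of \<open>x\<close> and \<open>y\<close>.\<close>

lemma conj_word_prod:
  "conj_on A2 (word_prod w z) = word_prod (conj_word z) (conj_word w)"
proof -
  define S where "S = (\<lambda>w z. {(u, x, y). w = x @ u \<and> z = conj_word u @ y})"
  have fin: "finite (S w z)" for w z
    unfolding S_def by (rule finite_word_prod_index)
  have eq: "word_prod w z = (\<Sum>(u, x, y)\<in>S w z. frag_of (x @ y))" for w z
    by (simp add: word_prod_def S_def)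
  have "conj_on A2 (word_prod w z) =
      (\<Sum>(u, x, y)\<in>S w z. frag_of (conj_word y @ conj_word x))"
    unfolding eq by (subst conj_on_sum[OF fin]) (auto intro!: sum.cong)
  also have "\<dots> = (\<Sum>(u, x, y)\<in>S (conj_word z) (conj_word w). frag_of (x @ y))"
    by (rule sum.reindex_bij_witness[where
          i = "\<lambda>(u, x, y). (u, conj_word y, conj_word x)" and
          j = "\<lambda>(u, x, y). (u, conj_word y, conj_word x)"])
       (auto simp: S_def, (metis conj_word_simps(3,4))+)
  finally show ?thesis
    by (simp only: eq)
qed

lemma conj_mul: "conj_on A2 (x \<star> y) = conj_on A2 y \<star> conj_on A2 x"
proof (induction x rule: frag_of_induct)
  case (one w)
  show ?case
    by (induction y rule: frag_of_induct)
       (simp_all add: conj_word_prod mul_diff_right mul_diff_left conj_on_diff)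
qed (simp_all add: mul_diff_left mul_diff_right conj_on_diff)

lemma tau_zero [simp]: "tau A2 0 = 0"
  by (simp add: tau_def)

lemma tau_diff: "tau A2 (x - y) = tau A2 x - tau A2 y"
  by (simp add: tau_def lookup_minus)

lemma tau_of [simp]: "tau A2 (frag_of w) = (if w = [] then 1 else 0)"
  by (simp add: tau_def)

lemma tau_conj [simp]: "tau A2 (conj_on A2 x) = tau A2 x"
  by (induction x rule: frag_of_induct) (simp_all add: conj_on_diff tau_diff)

lemma tau_word_prod: "tau A2 (word_prod w z) = (if z = conj_word w then 1 else 0)"
proof (induction w arbitrary: z rule: rev_induct)
  case (snoc a x)
  then show ?case
    by (cases z) (auto simp: word_prod_snoc_Cons tau_def lookup_add)
qed simp

text \<open>The trace pairs a word with its conjugate only; this turns conditions on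
  \<open>tau\<close> into conditions on multiplicities.\<close>

lemma tau_of_mul: "tau A2 (frag_of w \<star> x) = Poly_Mapping.lookup x (conj_word w)"
  by (induction x rule: frag_of_induct)
     (auto simp: mul_diff_right tau_diff tau_word_prod lookup_minus)

lemma tau_mul_commute: "tau A2 (x \<star> y) = tau A2 (y \<star> x)"
proof (induction x rule: frag_of_induct)
  case (one w)
  show ?case
    by (induction y rule: frag_of_induct)
       (auto simp: tau_word_prod mul_diff_right mul_diff_left tau_diff)
qed (simp_all add: mul_diff_left mul_diff_right tau_diff)

lemma lookup_word_prod_nonneg: "Poly_Mapping.lookup (word_prod w z) v \<ge> 0"
  unfolding word_prod_def by (auto simp: lookup_sum intro!: sum_nonneg)

lemma based_ring_A2: "based_ring A2"
proof (rule based_ring.intro)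
  \<comment> \<open>Symmetry of the trace moves \<gamma> to the front, where it reads off a
    coefficient of \<open>word_prod \<alpha> \<beta>\<close>.\<close>
  show "tau A2 (frag_of \<alpha> \<star> frag_of \<beta> \<star> frag_of \<gamma>) \<ge> 0" for \<alpha> \<beta> \<gamma>
    by (simp add: tau_mul_commute[of _ "frag_of \<gamma>"] tau_of_mul lookup_word_prod_nonneg)
qed (auto simp: ring_A2 conj_word_prod tau_word_prod)

lemma lookup_letter_mul:
  "Poly_Mapping.lookup (frag_of [a] \<star> x) w =
     (case w of [] \<Rightarrow> 0 | b # v \<Rightarrow> if b = a then Poly_Mapping.lookup x v else 0) +
     Poly_Mapping.lookup x (conj_letter a # w)"
proof (induction x rule: frag_of_induct)
  case (one z)
  show ?case
    by (cases z; cases w) (auto simp: word_prod_letter_Cons lookup_add)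
next
  case (diff x y)
  then show ?case
    by (auto simp: mul_diff_right lookup_minus split: list.split)
qed (simp split: list.split)

section \<open>The dimension function\<close>

text \<open>The values forced by \<open>frag_of_Cons\<close> once both letters have dimension 2:
  each maximal alternating block of n letters contributes a factor n + 1.\<close>

fun word_dim :: "letter list \<Rightarrow> int" where
  "word_dim [] = 1"
| "word_dim [a] = 2"
| "word_dim (a # b # w) = 2 * word_dim (b # w) - (if b = conj_letter a then word_dim w else 0)"

text \<open>Growth at \<open>w\<close> keeps the subtracted term below
  \<open>word_dim (b # w)\<close>, so doubling still yields an increase; without cancellation,
  positivity suffices.\<close>

lemma word_dim_less_Cons: "word_dim w > 0 \<and> word_dim w < word_dim (a # w)"
proof (induction w arbitrary: a)
  case (Cons b w)
  show ?case using Cons[of b] by auto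
qed simp

text \<open>The values are integers, so each letter adds at least 1.\<close>

lemma length_less_word_dim: "int (length w) < word_dim w"
proof (induction w)
  case (Cons a w)
  then show ?case using word_dim_less_Cons[of w a] by simp
qed simp

lemma word_dim_eq_1_iff: "word_dim w = 1 \<longleftrightarrow> w = []"
  using length_less_word_dim[of w] by (cases w) auto

definition A2_dim :: "(letter list \<Rightarrow>\<^sub>0 int) \<Rightarrow> int" where
  "A2_dim x = (\<Sum>w\<in>Poly_Mapping.keys x. Poly_Mapping.lookup x w * word_dim w)"

lemma dim_eq_sum:
  assumes "finite S" "Poly_Mapping.keys x \<subseteq> S"
  shows "A2_dim x = (\<Sum>w\<in>S. Poly_Mapping.lookup x w * word_dim w)"
  unfolding A2_dim_def using assms
  by (intro sum.mono_neutral_left) (auto simp: in_keys_iff)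

lemma dim_add: "A2_dim (x + y) = A2_dim x + A2_dim y"
proof -
  let ?S = "Poly_Mapping.keys x \<union> Poly_Mapping.keys y"
  have "A2_dim (x + y) = (\<Sum>w\<in>?S. Poly_Mapping.lookup (x + y) w * word_dim w)"
    using keys_add[of x y] by (intro dim_eq_sum) auto
  also have "\<dots> = (\<Sum>w\<in>?S. Poly_Mapping.lookup x w * word_dim w) +
      (\<Sum>w\<in>?S. Poly_Mapping.lookup y w * word_dim w)"
    by (simp add: lookup_add distrib_right sum.distrib)
  finally show ?thesis
    by (simp add: dim_eq_sum[of ?S])
qed

lemma dim_diff: "A2_dim (x - y) = A2_dim x - A2_dim y"
  using dim_add[of "x - y" y] by simp

lemma dim_zero [simp]: "A2_dim 0 = 0"
  by (simp add: A2_dim_def)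

lemma dim_of [simp]: "A2_dim (frag_of w) = word_dim w"
  by (simp add: A2_dim_def)

lemma dim_cmul: "A2_dim (frag_cmul k x) = k * A2_dim x"
  by (subst dim_eq_sum[of "Poly_Mapping.keys x"])
     (auto simp: A2_dim_def sum_distrib_left mult.assoc intro!: keys_cmul)

lemma dim_sum: "A2_dim (sum g A) = (\<Sum>i\<in>A. A2_dim (g i))"
  by (induction A rule: infinite_finite_induct) (simp_all add: dim_add)

lemma word_dim_le_dim:
  assumes "\<And>w. Poly_Mapping.lookup x w \<ge> 0" "w \<in> Poly_Mapping.keys x"
  shows "word_dim w \<le> A2_dim x"
proof -
  have pos: "word_dim v > 0" for v
    using word_dim_less_Cons by blast
  have "Poly_Mapping.lookup x w \<ge> 1"
    using assms(1)[of w] assms(2) by (simp add: in_keys_iff)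
  then have "word_dim w \<le> Poly_Mapping.lookup x w * word_dim w"
    using pos[of w] by simp
  also have "\<dots> \<le> A2_dim x"
    unfolding A2_dim_def using assms pos by (intro member_le_sum) (auto simp: less_imp_le)
  finally show ?thesis .
qed

lemma dim_letter_mul: "A2_dim (frag_of [a] \<star> x) = 2 * A2_dim x"
proof (induction x rule: frag_of_induct)
  case (one z)
  show ?case by (cases z) (simp_all add: word_prod_letter_Cons dim_add)
qed (simp_all add: mul_diff_right dim_diff)

lemma word_dim_Cons:
  "word_dim (a # w) =
     2 * word_dim w - (case w of [] \<Rightarrow> 0 | b # w' \<Rightarrow> if b = conj_letter a then word_dim w' else 0)"
  by (cases w) auto

lemma dim_of_mul: "A2_dim (frag_of w \<star> x) = word_dim w * A2_dim x"
proof (induction w rule: word_induct)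
  case (Cons a w)
  then show ?case
    unfolding frag_of_Cons[of a w] word_dim_Cons[of a w] mul_diff_left mul_assoc[symmetric]
      dim_diff dim_letter_mul
    by (auto simp: algebra_simps split: list.split)
qed simp

lemma dim_mul: "A2_dim (x \<star> y) = A2_dim x * A2_dim y"
  by (induction x rule: frag_of_induct)
     (simp_all add: dim_of_mul mul_diff_left dim_diff left_diff_distrib)

text \<open>By \<open>frag_of_Cons\<close> a homomorphism depends only on its values at the letters.
  This serves both the uniqueness of the dimension function and its invariance under
  conjugation.\<close>

lemma hom_eq_dim:
  fixes e :: "(letter list \<Rightarrow>\<^sub>0 int) \<Rightarrow> real"
  assumes add: "\<And>x y. e (x + y) = e x + e y" and mul: "\<And>x y. e (x \<star> y) = e x * e y"
    and one: "e (frag_of []) = 1" and two: "\<And>a. e (frag_of [a]) = 2"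
  shows "e x = of_int (A2_dim x)"
proof -
  have diff: "e (x - y) = e x - e y" for x y
    using add[of "x - y" y] by simp
  have "e 0 = 0"
    using diff[of 0 0] by simp
  have word: "e (frag_of w) = of_int (word_dim w)" for w
  proof (induction w rule: word_induct)
    case (Cons a w)
    then show ?case
      unfolding frag_of_Cons[of a w] word_dim_Cons[of a w] diff mul two
      by (auto simp: \<open>e 0 = 0\<close> split: list.split)
  qed (simp add: one)
  show ?thesis
    by (induction x rule: frag_of_induct) (simp_all add: \<open>e 0 = 0\<close> word diff dim_diff)
qed

lemma dim_conj: "A2_dim (conj_on A2 x) = A2_dim x"
proof -
  have "real_of_int (A2_dim (conj_on A2 x)) = of_int (A2_dim x)"
    \<comment> \<open>Conjugation reverses products, which does no harm because the values
      commute.\<close>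
    by (rule hom_eq_dim[where e = "\<lambda>x. of_int (A2_dim (conj_on A2 x))"])
       (simp_all add: conj_on_add dim_add conj_mul dim_mul)
  then show ?thesis by simp
qed

lemma dimension_function_dim: "dimension_function A2 (\<lambda>x. of_int (A2_dim x))"
  unfolding dimension_function_def
proof (intro conjI ring_hom_memI allI)
  show "0 < real_of_int (A2_dim (frag_of w))" for w
    using word_dim_less_Cons by simp
  show "real_of_int (A2_dim (frag_of w)) = of_int (A2_dim (conj_on A2 (frag_of w)))" for w
    by (simp only: dim_conj)
qed (simp_all add: ring_of_def real_ring_def dim_mul dim_add)

lemma dimension_function_eq_dim:
  assumes "dimension_function A2 d" "d (frag_of [Pi_plus]) = 2"
  shows "d = (\<lambda>x. of_int (A2_dim x))"
proof
  fix x
  have hom: "d \<in> ring_hom (ring_of A2) real_ring"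
    and conj: "\<And>w. d (frag_of w) = d (conj_on A2 (frag_of w))"
    using assms(1) by (auto simp: dimension_function_def)
  show "d x = of_int (A2_dim x)"
  proof (rule hom_eq_dim)
    show "d (x + y) = d x + d y" "d (x \<star> y) = d x * d y" for x y
      using ring_hom_add[OF hom, of x y] ring_hom_mult[OF hom, of x y]
      by (simp_all add: ring_of_def real_ring_def)
    show "d (frag_of []) = 1"
      using ring_hom_one[OF hom] by (simp add: ring_of_def real_ring_def)
    \<comment> \<open>The other letter is the conjugate of \<open>Pi_plus\<close>, so conjugation
      invariance fixes its value.\<close>
    show "d (frag_of [a]) = 2" for a
      using assms(2) conj[of "[Pi_plus]"] by (cases a) simp_all
  qed
qed

section \<open>Connected modules over \<open>A(2)\<close>\<close>

locale connected_A2_module = cofinite_based_module A2 M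
  for M :: "(letter list, 'j) based_module_data" +
  assumes connected: "connected_module A2 M"
begin

definition nbrs :: "letter \<Rightarrow> 'j \<Rightarrow> 'j set" where
  "nbrs a c = Poly_Mapping.keys (act M (frag_of [a]) (frag_of c))"

definition weight :: "letter \<Rightarrow> 'j \<Rightarrow> 'j \<Rightarrow> int" where
  "weight a c c' = Poly_Mapping.lookup (act M (frag_of [a]) (frag_of c)) c'"

lemma finite_nbrs [simp]: "finite (nbrs a c)"
  by (simp add: nbrs_def)

lemma in_nbrs_iff: "c' \<in> nbrs a c \<longleftrightarrow> weight a c c' \<noteq> 0"
  by (simp add: nbrs_def weight_def in_keys_iff)

lemma keys_act:
  assumes "Poly_Mapping.keys v \<subseteq> basis M"
  shows "Poly_Mapping.keys (act M r v) \<subseteq> basis M"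
  using act_hom_right[of r] assms by (auto simp: hom_def Pi_def)

lemma nbrs_subset: "c \<in> basis M \<Longrightarrow> nbrs a c \<subseteq> basis M"
  unfolding nbrs_def by (rule keys_act) (simp add: keys_frag_of)

lemma act_diff_right:
  assumes "Poly_Mapping.keys v \<subseteq> basis M" "Poly_Mapping.keys w \<subseteq> basis M"
  shows "act M r (v - w) = act M r v - act M r w"
  using hom_frag_diff[OF act_hom_right] assms by auto

lemma act_diff_left:
  assumes "Poly_Mapping.keys v \<subseteq> basis M"
  shows "act M (r - s) v = act M r v - act M s v"
  using hom_frag_diff[OF act_hom_left, of v r s] assms by auto

lemma act_zero_left:
  assumes "Poly_Mapping.keys v \<subseteq> basis M"
  shows "act M 0 v = 0"
  using act_diff_left[OF assms, of 0 0] by simp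

lemma act_zero_right: "act M r 0 = 0"
  using act_diff_right[of 0 0 r] by simp

lemma form_diff_left:
  assumes "Poly_Mapping.keys v \<subseteq> basis M" "Poly_Mapping.keys w \<subseteq> basis M" "c \<in> basis M"
  shows "form M (v - w) (frag_of c) = form M v (frag_of c) - form M w (frag_of c)"
  using hom_frag_diff[OF form_hom_left[of "frag_of c"], of v w] assms by auto

lemma form_zero_left:
  assumes "c \<in> basis M"
  shows "form M 0 (frag_of c) = 0"
  using form_diff_left[OF _ _ assms, of 0 0] by simp

lemma form_eq_frag_extend:
  assumes "Poly_Mapping.keys v \<subseteq> basis M" "c \<in> basis M"
  shows "form M v (frag_of c) = frag_extend (\<lambda>b. form M (frag_of b) (frag_of c)) v"
  using hom_eq_frag_extend[OF form_hom_left[of "frag_of c"], of v] assms by auto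

lemma form_act_left:
  assumes "Poly_Mapping.keys v \<subseteq> basis M" "c \<in> basis M"
  shows "form M (act M r v) (frag_of c) = r \<star> form M v (frag_of c)"
  using assms(1)
proof (rule free_Abelian_group_induct)
  show "form M (act M r 0) (frag_of c) = r \<star> form M 0 (frag_of c)"
    by (simp add: act_zero_right form_zero_left assms)
next
  fix x y
  assume "Poly_Mapping.keys x \<subseteq> basis M" "Poly_Mapping.keys y \<subseteq> basis M"
    "form M (act M r x) (frag_of c) = r \<star> form M x (frag_of c)"
    "form M (act M r y) (frag_of c) = r \<star> form M y (frag_of c)"
  then show "form M (act M r (x - y)) (frag_of c) = r \<star> form M (x - y) (frag_of c)"
    by (simp add: act_diff_right form_diff_left keys_act assms mul_diff_right)
next
  fix b assume b: "b \<in> basis M"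
  then have kb: "Poly_Mapping.keys (frag_of b) \<subseteq> basis M"
    by (simp add: keys_frag_of)
  show "form M (act M r (frag_of b)) (frag_of c) = r \<star> form M (frag_of b) (frag_of c)"
    by (induction r rule: frag_of_induct)
       (simp_all add: act_diff_left form_diff_left keys_act assms kb mul_diff_left
          act_zero_left form_zero_left form_act b)
qed

lemma lookup_eq_tau_form:
  assumes "Poly_Mapping.keys v \<subseteq> basis M" "c \<in> basis M"
  shows "Poly_Mapping.lookup v c = tau A2 (form M v (frag_of c))"
proof -
  have "tau A2 (form M v (frag_of c)) =
      (\<Sum>b\<in>Poly_Mapping.keys v. Poly_Mapping.lookup v b * (if b = c then 1 else 0))"
    unfolding form_eq_frag_extend[OF assms] tau_def lookup_frag_extend
    using assms tau_form[unfolded tau_def] by (intro sum.cong) auto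
  also have "\<dots> = (\<Sum>b\<in>Poly_Mapping.keys v. if b = c then Poly_Mapping.lookup v b else 0)"
    by (intro sum.cong) auto
  also have "\<dots> = Poly_Mapping.lookup v c"
    by (simp add: in_keys_iff)
  finally show ?thesis ..
qed

lemma lookup_act:
  assumes "b \<in> basis M" "c \<in> basis M"
  shows "Poly_Mapping.lookup (act M (frag_of \<alpha>) (frag_of b)) c = mult_coeff A2 M \<alpha> b c"
  using assms
  by (subst lookup_eq_tau_form) (auto simp: keys_frag_of keys_act mult_coeff_def form_act)

lemma lookup_form:
  "Poly_Mapping.lookup (form M (frag_of b) (frag_of c)) w = mult_coeff A2 M (conj_word w) b c"
  by (simp add: mult_coeff_def tau_of_mul)

lemma lookup_form_nonneg:
  assumes "b \<in> basis M" "c \<in> basis M"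
  shows "Poly_Mapping.lookup (form M (frag_of b) (frag_of c)) w \<ge> 0"
  using tau_prod_form_nonneg[OF assms] by (simp add: lookup_form mult_coeff_def)

lemma form_nonzero:
  assumes "b \<in> basis M" "c \<in> basis M"
  shows "form M (frag_of b) (frag_of c) \<noteq> 0"
  using connected assms unfolding connected_module_def mult_coeff_def by fastforce

lemma weight_eq:
  assumes "c \<in> basis M" "c' \<in> basis M"
  shows "weight a c c' = mult_coeff A2 M [a] c c'"
  using lookup_act[OF assms] by (simp add: weight_def)

lemma weight_nonneg: "c \<in> basis M \<Longrightarrow> c' \<in> basis M \<Longrightarrow> weight a c c' \<ge> 0"
  using tau_prod_form_nonneg by (simp add: weight_eq mult_coeff_def)

text \<open>Frobenius reciprocity: conjugation under the trace swaps the arguments of the form and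
  puts the conjugate letter on the right; symmetry of the trace brings it back to the left.\<close>

lemma weight_conj:
  assumes "c \<in> basis M" "c' \<in> basis M"
  shows "weight (conj_letter a) c' c = weight a c c'"
proof -
  have "mult_coeff A2 M [a] c c' =
      tau A2 (conj_on A2 (frag_of [a] \<star> form M (frag_of c) (frag_of c')))"
    by (simp only: mult_coeff_def tau_conj)
  also have "\<dots> = tau A2 (form M (frag_of c') (frag_of c) \<star> frag_of [conj_letter a])"
    by (simp add: conj_mul form_conj[OF assms])
  also have "\<dots> = mult_coeff A2 M [conj_letter a] c' c"
    by (simp only: mult_coeff_def tau_mul_commute)
  finally show ?thesis
    using assms by (simp add: weight_eq)
qed

lemma nbrs_sym:
  assumes "c \<in> basis M" "c' \<in> nbrs a c"
  shows "c \<in> nbrs (conj_letter a) c'"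
  using assms nbrs_subset[of c a] weight_conj[of c c' a] by (auto simp: in_nbrs_iff)

lemma weight_pos: "c \<in> basis M \<Longrightarrow> c' \<in> nbrs a c \<Longrightarrow> weight a c c' \<ge> 1"
  using weight_nonneg[of c c' a] nbrs_subset[of c a] by (force simp: in_nbrs_iff)

text \<open>Taking dimensions here gives harmonicity; comparing coefficients gives upper
  neighbours.\<close>

lemma letter_mul_form:
  assumes "b \<in> basis M" "c \<in> basis M"
  shows "frag_of [a] \<star> form M (frag_of c) (frag_of b) =
     (\<Sum>c'\<in>nbrs a c. frag_cmul (weight a c c') (form M (frag_of c') (frag_of b)))"
proof -
  have "frag_of [a] \<star> form M (frag_of c) (frag_of b) =
      form M (act M (frag_of [a]) (frag_of c)) (frag_of b)"
    using assms by (simp add: form_act)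
  also have "\<dots> = (\<Sum>c'\<in>nbrs a c. frag_cmul (weight a c c') (form M (frag_of c') (frag_of b)))"
    using assms
    by (subst form_eq_frag_extend) (auto simp: keys_act keys_frag_of frag_extend_def nbrs_def weight_def)
  finally show ?thesis .
qed

end

section \<open>Dimension and degree seen from a base point \<open>p\<close>\<close>

locale pointed_A2_module = connected_A2_module +
  fixes p
  assumes p: "p \<in> basis M"
begin

abbreviation coord :: "'a \<Rightarrow> letter list \<Rightarrow>\<^sub>0 int" where
  "coord c \<equiv> form M (frag_of c) (frag_of p)"

definition mdim :: "'a \<Rightarrow> int" where
  "mdim c = A2_dim (coord c)"

definition deg :: "'a \<Rightarrow> nat" where
  "deg c = Max (length ` Poly_Mapping.keys (coord c))"

lemma length_le_deg: "w \<in> Poly_Mapping.keys (coord c) \<Longrightarrow> length w \<le> deg c"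
  unfolding deg_def by (intro Max_ge) auto

lemma deg_attained:
  assumes "c \<in> basis M"
  shows "\<exists>w\<in>Poly_Mapping.keys (coord c). length w = deg c"
proof -
  have "Poly_Mapping.keys (coord c) \<noteq> {}"
    using form_nonzero[OF assms p] by simp
  then have "deg c \<in> length ` Poly_Mapping.keys (coord c)"
    unfolding deg_def by (intro Max_in) auto
  then show ?thesis by auto
qed

text \<open>Remembers by which letter \<open>c\<close> is reached from below; for a basis element
  there is at most one such letter.\<close>

definition leads_with :: "letter \<Rightarrow> 'a \<Rightarrow> bool" where
  "leads_with a c \<longleftrightarrow> (\<forall>w\<in>Poly_Mapping.keys (coord c). length w = deg c \<longrightarrow> (\<exists>v. w = a # v))"

lemma leads_with_unique: "c \<in> basis M \<Longrightarrow> leads_with a c \<Longrightarrow> leads_with b c \<Longrightarrow> a = b"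
  using deg_attained[of c] unfolding leads_with_def by blast

text \<open>Coefficients being non-negative, \<open>mdim c\<close> is at least the dimension of a
  longest word, which exceeds its length.\<close>

lemma deg_less_mdim:
  assumes "c \<in> basis M"
  shows "int (deg c) < mdim c"
proof -
  obtain w where w: "w \<in> Poly_Mapping.keys (coord c)" "length w = deg c"
    using deg_attained[OF assms] by blast
  then show ?thesis
    using word_dim_le_dim[OF lookup_form_nonneg[OF assms p] w(1)] length_less_word_dim[of w]
    by (simp add: mdim_def)
qed

lemma mdim_pos: "c \<in> basis M \<Longrightarrow> mdim c > 0"
  using deg_less_mdim[of c] by linarith

lemma mdim_harmonic:
  assumes "c \<in> basis M"
  shows "2 * mdim c = (\<Sum>c'\<in>nbrs a c. weight a c c' * mdim c')"
proof -
  have "2 * mdim c = A2_dim (frag_of [a] \<star> coord c)"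
    by (simp add: dim_letter_mul mdim_def)
  then show ?thesis
    by (simp add: letter_mul_form[OF p assms] dim_sum dim_cmul mdim_def)
qed

text \<open>By reciprocity \<open>c\<close> is a neighbour of \<open>c'\<close> with the same
  weight, and one term of the harmonic sum at \<open>c'\<close> is at most the whole sum.\<close>

lemma mdim_nbr_ge:
  assumes c: "c \<in> basis M" and c': "c' \<in> nbrs a c"
  shows "weight a c c' * mdim c \<le> 2 * mdim c'"
proof -
  let ?b = "conj_letter a"
  have c'_basis: "c' \<in> basis M"
    using nbrs_subset[OF c] c' by blast
  have "weight ?b c' d * mdim d \<ge> 0" if "d \<in> nbrs ?b c'" for d
    using that nbrs_subset[OF c'_basis] weight_pos[OF c'_basis that] mdim_pos[of d] by force
  then have "weight ?b c' c * mdim c \<le> (\<Sum>d\<in>nbrs ?b c'. weight ?b c' d * mdim d)"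
    using nbrs_sym[OF c c'] by (intro member_le_sum) auto
  then show ?thesis
    using weight_conj[OF c c'_basis] mdim_harmonic[OF c'_basis, of ?b] by simp
qed

text \<open>By harmonicity the neighbours of \<open>c\<close> other than \<open>c'\<close> have total \<open>mdim\<close> less than \<open>mdim c\<close>,
  while each of them has at least half of \<open>mdim c\<close>.\<close>

lemma nbrs_if_larger_nbr:
  assumes c: "c \<in> basis M" and c': "c' \<in> nbrs a c" and less: "mdim c < mdim c'"
  shows "act M (frag_of [a]) (frag_of c) = frag_of c' \<or>
    (\<exists>d. d \<noteq> c' \<and> d \<in> nbrs a c \<and> mdim d < mdim c \<and>
       act M (frag_of [a]) (frag_of c) = frag_of c' + frag_of d)"
proof -
  let ?R = "nbrs a c - {c'}"
  let ?rest = "\<Sum>d\<in>?R. weight a c d * mdim d"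
  have sub: "nbrs a c \<subseteq> basis M"
    using nbrs_subset[OF c] .
  have weight: "weight a c d \<ge> 1" if "d \<in> nbrs a c" for d
    using weight_pos[OF c that] .
  have mdim: "mdim d > 0" if "d \<in> nbrs a c" for d
    using that sub mdim_pos by blast
  have nonneg: "weight a c d * mdim d \<ge> 0" if "d \<in> nbrs a c" for d
    using weight[OF that] mdim[OF that] by simp
  have split: "2 * mdim c = weight a c c' * mdim c' + ?rest"
    unfolding mdim_harmonic[OF c, of a] using c' by (subst sum.remove) auto
  have rest_nonneg: "?rest \<ge> 0"
    using nonneg by (intro sum_nonneg) blast
  have one: "weight a c c' = 1"
  proof (rule ccontr)
    assume "weight a c c' \<noteq> 1"
    then have "2 * mdim c' \<le> weight a c c' * mdim c'"
      using weight[OF c'] mdim[OF c'] by (intro mult_right_mono) auto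
    then show False using split rest_nonneg less by linarith
  qed
  have rest: "?rest < mdim c"
    using split less by (simp add: one)
  show ?thesis
  proof (cases "?R = {}")
    case True
    have "act M (frag_of [a]) (frag_of c) = frag_of c'"
    proof (rule poly_mapping_eqI)
      fix x
      have "x \<notin> nbrs a c \<or> x = c'" using True by auto
      then show "Poly_Mapping.lookup (act M (frag_of [a]) (frag_of c)) x =
          Poly_Mapping.lookup (frag_of c') x"
        using one c' by (auto simp: in_nbrs_iff weight_def)
    qed
    then show ?thesis by blast
  next
    case False
    then obtain d where d: "d \<in> nbrs a c" "d \<noteq> c'" by blast
    let ?rest' = "\<Sum>e\<in>?R - {d}. weight a c e * mdim e"
    have rest_d: "?rest = weight a c d * mdim d + ?rest'"
      using d by (intro sum.remove) auto
    have rest'_nonneg: "?rest' \<ge> 0"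
      using nonneg by (intro sum_nonneg) blast
    have half: "weight a c e * mdim c \<le> 2 * mdim e" if "e \<in> nbrs a c" for e
      using mdim_nbr_ge[OF c that] .
    have weight_size: "mdim e \<le> weight a c e * mdim e" "mdim c \<le> weight a c e * mdim c"
      if "e \<in> nbrs a c" for e
      using weight[OF that] mdim[OF that] mdim_pos[OF c] by simp_all
    \<comment> \<open>With weight at least 2, \<open>half\<close> would give \<open>mdim d\<close>
      at least \<open>mdim c\<close>, exceeding the total of all neighbours other than
      \<open>c'\<close>.\<close>
    have oned: "weight a c d = 1"
    proof (rule ccontr)
      assume "weight a c d \<noteq> 1"
      then have "2 * mdim c \<le> weight a c d * mdim c"
        using weight[OF d(1)] mdim_pos[OF c] by (intro mult_right_mono) auto
      then show False
        using half[OF d(1)] weight_size(1)[OF d(1)] rest rest_d rest'_nonneg by linarith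
    qed
    have "?R - {d} = {}"
    proof (rule ccontr)
      assume "?R - {d} \<noteq> {}"
      then obtain e where e: "e \<in> nbrs a c" "e \<in> ?R - {d}" by blast
      then have "weight a c e * mdim e \<le> ?rest'"
        using nonneg by (intro member_le_sum) auto
      then show False
        using half[OF d(1)] half[OF e(1)] weight_size[OF d(1)] weight_size[OF e(1)] rest rest_d
        by linarith
    qed
    then have nb: "nbrs a c = {c', d}" using c' d by auto
    have "act M (frag_of [a]) (frag_of c) = frag_of c' + frag_of d"
    proof (rule poly_mapping_eqI)
      fix x
      have "weight a c x = (if x = c' then 1 else if x = d then 1 else 0)"
        using one oned nb in_nbrs_iff[of x a c] by auto
      then show "Poly_Mapping.lookup (act M (frag_of [a]) (frag_of c)) x =
          Poly_Mapping.lookup (frag_of c' + frag_of d) x"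
        using d by (auto simp: weight_def lookup_add)
    qed
    moreover have "mdim d < mdim c"
      using rest rest_d rest'_nonneg oned by simp
    ultimately show ?thesis using d by blast
  qed
qed

lemma nbr_cases:
  assumes "c \<in> basis M" "c' \<in> nbrs a c" "mdim c < mdim c'" "d \<in> nbrs a c"
  shows "d = c' \<or> mdim d < mdim c"
  using nbrs_if_larger_nbr[OF assms(1-3)] assms(4)
  by (auto simp: in_nbrs_iff weight_def lookup_add split: if_splits)

text \<open>For a longest word \<open>v\<close> of \<open>coord c\<close>, the word
  \<open>a # v\<close> survives in the product with \<open>a\<close>, hence occurs in some
  \<open>coord c'\<close>. As nothing cancels between neighbours, all words of
  \<open>coord c'\<close> occur in that product, which bounds their length and fixes the first
  letter of the longest ones.\<close>

lemma ex_upper_nbr: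
  assumes c: "c \<in> basis M"
  shows "\<exists>c'\<in>nbrs a c. deg c' = Suc (deg c) \<and> leads_with a c'"
proof -
  obtain v where v: "v \<in> Poly_Mapping.keys (coord c)" "length v = deg c"
    using deg_attained[OF c] by blast
  have lookup_sum: "Poly_Mapping.lookup (frag_of [a] \<star> coord c) w =
      (\<Sum>c'\<in>nbrs a c. weight a c c' * Poly_Mapping.lookup (coord c') w)" for w
    by (simp add: letter_mul_form[OF p c] lookup_sum)
  have nonneg: "weight a c c' * Poly_Mapping.lookup (coord c') w \<ge> 0" if "c' \<in> nbrs a c" for c' w
  proof -
    have "c' \<in> basis M"
      using that nbrs_subset[OF c] by blast
    then show ?thesis
      using weight_pos[OF c that] lookup_form_nonneg[OF _ p] by simp
  qed
  have keys: "w \<in> Poly_Mapping.keys (frag_of [a] \<star> coord c)"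
    if "c' \<in> nbrs a c" "w \<in> Poly_Mapping.keys (coord c')" for c' w
  proof -
    have "weight a c c' * Poly_Mapping.lookup (coord c') w \<noteq> 0"
      using that by (simp add: in_keys_iff in_nbrs_iff)
    then show ?thesis
      unfolding in_keys_iff lookup_sum using that(1) nonneg
      by (subst sum_nonneg_eq_0_iff) auto
  qed
  have keys_mul: "length w \<le> Suc (deg c) \<and> (length w = Suc (deg c) \<longrightarrow> (\<exists>u. w = a # u))"
    if w: "w \<in> Poly_Mapping.keys (frag_of [a] \<star> coord c)" for w
  proof -
    consider "conj_letter a # w \<in> Poly_Mapping.keys (coord c)"
      | u where "w = a # u" "u \<in> Poly_Mapping.keys (coord c)"
      using w by (cases w; cases "Poly_Mapping.lookup (coord c) (conj_letter a # w) = 0")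
        (auto simp: in_keys_iff lookup_letter_mul split: if_splits)
    then show ?thesis
      by cases (auto dest: length_le_deg)
  qed
  \<comment> \<open>The other source of the coefficient of \<open>a # v\<close> is a word too long
    to occur.\<close>
  have "conj_letter a # a # v \<notin> Poly_Mapping.keys (coord c)"
    using length_le_deg[of "conj_letter a # a # v" c] v(2) by auto
  then have "Poly_Mapping.lookup (frag_of [a] \<star> coord c) (a # v) \<noteq> 0"
    using v(1) by (simp add: lookup_letter_mul in_keys_iff)
  then obtain c' where c': "c' \<in> nbrs a c" "a # v \<in> Poly_Mapping.keys (coord c')"
    unfolding lookup_sum by (metis (no_types, lifting) in_keys_iff mult_zero_right sum.neutral)
  have c'_basis: "c' \<in> basis M"
    using nbrs_subset[OF c] c'(1) by blast
  have "deg c' = Suc (deg c)"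
  proof (rule antisym)
    show "Suc (deg c) \<le> deg c'"
      using length_le_deg[OF c'(2)] v(2) by simp
    show "deg c' \<le> Suc (deg c)"
      using deg_attained[OF c'_basis] keys[OF c'(1)] keys_mul by metis
  qed
  moreover from this have "leads_with a c'"
    unfolding leads_with_def using keys[OF c'(1)] keys_mul by auto
  ultimately show ?thesis using c'(1) by blast
qed

text \<open>If \<open>mdim\<close> does not increase from \<open>c\<close> to the upper neighbour \<open>c'\<close>, then it never increases
  along the path of upper neighbours that starts there, and this contradicts \<open>deg_less_mdim\<close>.\<close>

lemma upper_nbr_larger:
  assumes "c \<in> basis M" "c' \<in> nbrs a c" "deg c' = Suc (deg c)"
  shows "mdim c < mdim c'"
proof (rule ccontr)
  assume "\<not> mdim c < mdim c'"
  \<comment> \<open>Here \<open>n\<close> counts upward steps, each raising \<open>deg\<close> by 1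
    without raising \<open>mdim\<close>; the bound is carried back from the end of the path to its
    start.\<close>
  then have "int (deg c) + int n < mdim c" for n
    using assms
  proof (induction n arbitrary: c c' a)
    case 0
    then show ?case using deg_less_mdim by simp
  next
    case (Suc n)
    have c': "c' \<in> basis M"
      using nbrs_subset Suc.prems by blast
    obtain d where d: "d \<in> nbrs (conj_letter a) c'" "deg d = Suc (deg c')"
      using ex_upper_nbr[OF c'] by blast
    have c_nbr: "c \<in> nbrs (conj_letter a) c'"
      using nbrs_sym Suc.prems by blast
    \<comment> \<open>Otherwise \<open>c\<close>, a neighbour of \<open>c'\<close>, would be either
      \<open>d\<close>, whose degree is higher by 2, or smaller than \<open>c'\<close>, against the
      assumption.\<close>
    have "\<not> mdim c' < mdim d"
    proof
      assume "mdim c' < mdim d"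
      then have "c = d \<or> mdim c < mdim c'"
        using nbr_cases[OF c' d(1) _ c_nbr] by blast
      then show False using Suc.prems d(2) by auto
    qed
    then have "int (deg c') + int n < mdim c'"
      using Suc.IH[OF _ c' d] by blast
    then show ?case using Suc.prems by simp
  qed
  from this[of "nat (mdim c)"] show False
    using mdim_pos[OF assms(1)] by simp
qed

lemma ex_larger_nbr:
  assumes "c \<in> basis M"
  shows "\<exists>c'\<in>nbrs a c. mdim c < mdim c' \<and> leads_with a c'"
  using ex_upper_nbr[OF assms] upper_nbr_larger[OF assms] by blast

text \<open>By \<open>nbr_cases\<close> the larger neighbour is unique, so it is the one from
  \<open>ex_larger_nbr\<close>.\<close>

lemma larger_nbr_leads_with:
  assumes "c \<in> basis M" "c' \<in> nbrs a c" "mdim c < mdim c'"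
  shows "leads_with a c'"
proof -
  obtain d where d: "d \<in> nbrs a c" "mdim c < mdim d" "leads_with a d"
    using ex_larger_nbr[OF assms(1)] by blast
  then have "d = c'"
    using nbr_cases[OF assms d(1)] by auto
  then show ?thesis using d by simp
qed

lemma mdim_act_word:
  assumes "b \<in> basis M" "act M (frag_of w) (frag_of b) = frag_of c"
  shows "mdim c = word_dim w * mdim b"
  using form_act[OF assms(1) p, of w] by (simp add: assms(2) mdim_def dim_of_mul)

text \<open>If \<open>w\<close> takes \<open>b\<close> to \<open>c\<close>, the question is whether
  \<open>a\<close> takes \<open>c\<close> to its larger neighbour alone or also to a smaller one.
  For empty \<open>w\<close>, minimality forbids the smaller one. If \<open>a\<close> repeats the
  first letter of \<open>w\<close>, it would make \<open>c\<close> lead with two different letters.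
  If \<open>a\<close> cancels that letter, it does appear and is exactly the term that
  \<open>frag_of_Cons\<close> subtracts.\<close>

lemma act_word_minimal:
  assumes b: "b \<in> basis M" and min: "\<And>c. c \<in> basis M \<Longrightarrow> mdim b \<le> mdim c"
  shows "\<exists>c\<in>basis M. act M (frag_of w) (frag_of b) = frag_of c"
proof (induction w rule: word_induct)
  case Nil
  show ?case using act_unit[of "frag_of b"] b by auto
next
  case (Cons a w)
  have kb: "Poly_Mapping.keys (frag_of b) \<subseteq> basis M"
    using b by (simp add: keys_frag_of)
  have act_mul: "act M (r \<star> s) (frag_of b) = act M r (act M s (frag_of b))" for r s
    using act_prod kb by simp
  obtain c where c: "c \<in> basis M" "act M (frag_of w) (frag_of b) = frag_of c"
    using Cons.IH(1) by blast
  obtain c' where c': "c' \<in> nbrs a c" "mdim c < mdim c'"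
    using ex_larger_nbr[OF c(1)] by blast
  have c'_basis: "c' \<in> basis M"
    using nbrs_subset c c' by blast
  show ?case
  proof (cases w)
    case Nil
    then have "c = b"
      using mdim_act_word[OF b c(2)] c(2) act_unit[of "frag_of b"] kb by (simp add: frag_of_eq)
    have "\<not> mdim d < mdim c" if "d \<in> nbrs a c" for d
      using min[of d] nbrs_subset[OF c(1)] that \<open>c = b\<close> by (auto simp: not_less)
    then have "act M (frag_of [a]) (frag_of c) = frag_of c'"
      using nbrs_if_larger_nbr[OF c(1) c'] by blast
    then show ?thesis using Nil c'_basis \<open>c = b\<close> by blast
  next
    case (Cons e w')
    obtain d where d: "d \<in> basis M" "act M (frag_of w') (frag_of b) = frag_of d"
      using Cons.IH(2)[OF Cons] by blast
    have "mdim d < mdim c"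
      unfolding mdim_act_word[OF b c(2)] mdim_act_word[OF b d(2)] Cons
      using word_dim_less_Cons[of w' e] mdim_pos[OF b] by simp
    have down: "act M (frag_of (conj_letter e # w)) (frag_of b) =
        act M (frag_of [conj_letter e]) (frag_of c) - frag_of d"
      unfolding frag_of_Cons[of _ w] act_diff_left[OF kb] act_mul c(2)
      by (simp add: Cons d(2))
    \<comment> \<open>By \<open>down\<close> this coefficient is the weight of \<open>d\<close>
      minus 1, so the weight is positive.\<close>
    have "0 \<le> Poly_Mapping.lookup (act M (frag_of (conj_letter e # w)) (frag_of b)) d"
      using lookup_act[OF b d(1)] tau_prod_form_nonneg[OF b d(1)] by (simp add: mult_coeff_def)
    then have d_nbr: "d \<in> nbrs (conj_letter e) c"
      unfolding down by (simp add: in_nbrs_iff weight_def lookup_minus)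
    show ?thesis
    proof (cases "a = e")
      case True
      have "leads_with e c"
        using larger_nbr_leads_with[OF d(1) _ \<open>mdim d < mdim c\<close>] nbrs_sym[OF c(1) d_nbr] by simp
      have "act M (frag_of [a]) (frag_of c) = frag_of c'"
      proof (rule ccontr)
        assume "act M (frag_of [a]) (frag_of c) \<noteq> frag_of c'"
        then obtain c'' where c'': "c'' \<in> nbrs a c" "mdim c'' < mdim c"
          using nbrs_if_larger_nbr[OF c(1) c'] by blast
        then have "c'' \<in> basis M"
          using nbrs_subset[OF c(1)] by blast
        then have "leads_with (conj_letter a) c"
          using larger_nbr_leads_with nbrs_sym[OF c(1) c''(1)] c''(2) by blast
        then have "e = conj_letter a"
          by (rule leads_with_unique[OF c(1) \<open>leads_with e c\<close>])
        then show False
          using True by simp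
      qed
      moreover have "act M (frag_of (a # w)) (frag_of b) = act M (frag_of [a]) (frag_of c)"
        unfolding frag_of_Cons[of a w] act_diff_left[OF kb] act_mul c(2)
        by (simp add: Cons True act_zero_left b)
      ultimately show ?thesis
        using c'_basis by metis
    next
      case False
      then have a: "a = conj_letter e"
        using letter_eq_or_conj by blast
      have "d \<noteq> c'"
        using \<open>mdim d < mdim c\<close> c'(2) by auto
      have "Poly_Mapping.lookup (act M (frag_of [a]) (frag_of c)) d \<noteq> 0"
        using d_nbr by (simp add: a in_nbrs_iff weight_def)
      with \<open>d \<noteq> c'\<close> have "act M (frag_of [a]) (frag_of c) \<noteq> frag_of c'"
        by auto
      then obtain d' where d': "act M (frag_of [a]) (frag_of c) = frag_of c' + frag_of d'"
        using nbrs_if_larger_nbr[OF c(1) c'] by blast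
      then have "d = d'"
        using \<open>Poly_Mapping.lookup _ d \<noteq> 0\<close> \<open>d \<noteq> c'\<close>
        by (simp add: lookup_add split: if_splits)
      then have "act M (frag_of (a # w)) (frag_of b) = frag_of c'"
        using down d' by (simp add: a)
      then show ?thesis
        using c'_basis by blast
    qed
  qed
qed

end

section \<open>Freeness and the isomorphism\<close>

context connected_A2_module
begin

lemma ex_free_generator:
  assumes "basis M \<noteq> {}"
  shows "\<exists>b\<in>basis M. form M (frag_of b) (frag_of b) = frag_of [] \<and>
    (\<forall>w. \<exists>c\<in>basis M. act M (frag_of w) (frag_of b) = frag_of c)"
proof -
  obtain p where "p \<in> basis M"
    using assms by blast
  then interpret pointed_A2_module M p
    by unfold_locales
  obtain b where b: "b \<in> basis M" and min: "\<And>c. c \<in> basis M \<Longrightarrow> nat (mdim b) \<le> nat (mdim c)"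
    using ex_has_least_nat[of "\<lambda>c. c \<in> basis M" p "\<lambda>c. nat (mdim c)"] p by blast
  then have min': "mdim b \<le> mdim c" if "c \<in> basis M" for c
    using mdim_pos[OF b] min[OF that] by linarith
  have word: "\<exists>c\<in>basis M. act M (frag_of w) (frag_of b) = frag_of c" for w
    by (rule act_word_minimal[OF b min'])
  have "form M (frag_of b) (frag_of b) = frag_of []"
  proof (rule poly_mapping_eqI)
    fix w
    obtain c where c: "c \<in> basis M" "act M (frag_of (conj_word w)) (frag_of b) = frag_of c"
      using word by blast
    \<comment> \<open>Since \<open>mdim\<close> is multiplied by the dimension of the word,
      returning to \<open>b\<close> forces dimension 1.\<close>
    have "c = b \<longleftrightarrow> w = []"
    proof
      assume "c = b"
      then show "w = []"
        using mdim_act_word[OF b c(2)] mdim_pos[OF b] by (simp add: word_dim_eq_1_iff)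
    next
      assume "w = []"
      then have "frag_of c = frag_of b"
        using c(2) act_unit[of "frag_of b"] b by (simp add: keys_frag_of)
      then show "c = b" by (simp add: frag_of_eq)
    qed
    moreover have "Poly_Mapping.lookup (form M (frag_of b) (frag_of b)) w = (if b = c then 1 else 0)"
      using lookup_act[OF b b, of "conj_word w"] by (simp add: lookup_form c(2))
    ultimately show "Poly_Mapping.lookup (form M (frag_of b) (frag_of b)) w =
        Poly_Mapping.lookup (frag_of []) w"
      by auto
  qed
  then show ?thesis
    using b word by blast
qed

text \<open>Acting on \<open>b\<close> inverts \<phi>: one composite is the identity because the
  form of \<open>b\<close> with itself is 1, the other because by connectedness each basis element
  occurs in, hence equals, the image of \<open>b\<close> under some word.\<close>

lemma ex_iso_standard:
  assumes "basis M \<noteq> {}"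
  shows "\<exists>\<phi>. based_module_iso M (standard_module A2) \<phi>"
proof -
  obtain b where b: "b \<in> basis M" and one: "form M (frag_of b) (frag_of b) = frag_of []"
    and word: "\<And>w. \<exists>c\<in>basis M. act M (frag_of w) (frag_of b) = frag_of c"
    using ex_free_generator[OF assms] by blast
  have kb: "Poly_Mapping.keys (frag_of b) \<subseteq> basis M"
    using b by (simp add: keys_frag_of)
  define \<phi> where "\<phi> = (\<lambda>v. form M v (frag_of b))"
  have \<phi>_act: "\<phi> (act M r v) = r \<star> \<phi> v" if "Poly_Mapping.keys v \<subseteq> basis M" for r v
    unfolding \<phi>_def by (rule form_act_left[OF that b])
  have \<phi>_inv: "\<phi> (act M r (frag_of b)) = r" for r
    using \<phi>_act[OF kb] by (simp add: \<phi>_def one)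
  have reach: "\<exists>w. frag_of c = act M (frag_of w) (frag_of b)" if c: "c \<in> basis M" for c
  proof -
    obtain w where w: "mult_coeff A2 M w b c \<noteq> 0"
      using connected b c unfolding connected_module_def by blast
    obtain c' where "act M (frag_of w) (frag_of b) = frag_of c'"
      using word by blast
    with w lookup_act[OF b c, of w] show ?thesis
      by (metis lookup_frag_of)
  qed
  have inv_\<phi>: "act M (\<phi> v) (frag_of b) = v" if "Poly_Mapping.keys v \<subseteq> basis M" for v
    using that
  proof (rule free_Abelian_group_induct)
    show "act M (\<phi> 0) (frag_of b) = 0"
      by (simp add: \<phi>_def form_zero_left b act_zero_left kb)
  next
    fix x y
    assume "Poly_Mapping.keys x \<subseteq> basis M" "Poly_Mapping.keys y \<subseteq> basis M"
      "act M (\<phi> x) (frag_of b) = x" "act M (\<phi> y) (frag_of b) = y"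
    then show "act M (\<phi> (x - y)) (frag_of b) = x - y"
      by (simp add: \<phi>_def form_diff_left b act_diff_left kb)
  next
    fix c assume "c \<in> basis M"
    then obtain w where "frag_of c = act M (frag_of w) (frag_of b)"
      using reach by blast
    then show "act M (\<phi> (frag_of c)) (frag_of b) = frag_of c"
      by (simp add: \<phi>_inv)
  qed
  have "bij_betw \<phi> (carrier (lattice M)) (carrier (free_Abelian_group UNIV))"
    by (rule bij_betw_byWitness[where f' = "\<lambda>r. act M r (frag_of b)"])
       (use \<phi>_inv inv_\<phi> keys_act[OF kb] in auto)
  moreover have "\<phi> \<in> hom (lattice M) (free_Abelian_group UNIV)"
    unfolding \<phi>_def using form_hom_left kb by simp
  moreover have "\<exists>w. \<phi> (frag_of c) = frag_of w" if "c \<in> basis M" for c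
    using reach[OF that] \<phi>_inv by metis
  ultimately have "based_module_iso M (standard_module A2) \<phi>"
    by (auto simp: based_module_iso_def standard_module_def iso_def \<phi>_act)
  then show ?thesis by blast
qed

end

theorem theorem1p24:
  "fusion_ring A2 \<and>
   (\<exists>!d. dimension_function A2 d \<and> d (frag_of [Pi_plus]) = 2) \<and>
   torsion_free TYPE('j) A2"
proof (intro conjI)
  show "fusion_ring A2"
    using based_ring_A2 dimension_function_dim by (auto simp: fusion_ring_def)
  show "\<exists>!d. dimension_function A2 d \<and> d (frag_of [Pi_plus]) = 2"
  proof (rule ex1I)
    show "dimension_function A2 (\<lambda>x. real_of_int (A2_dim x)) \<and> real_of_int (A2_dim (frag_of [Pi_plus])) = 2"
      by (simp add: dimension_function_dim)
  qed (blast intro: dimension_function_eq_dim)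
  show "torsion_free TYPE('j) A2"
    unfolding torsion_free_def
  proof (intro allI impI)
    fix M :: "(letter list, 'j) based_module_data"
    assume "cofinite_based_module A2 M" "connected_module A2 M"
    then interpret connected_A2_module M
      by (intro connected_A2_module.intro connected_A2_module_axioms.intro)
    show "\<exists>\<phi>. based_module_iso M (standard_module A2) \<phi>" if "basis M \<noteq> {}"
      using that by (rule ex_iso_standard)
  qed
qed

end
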